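(* For integers $k,n>0$, $$(-1)^k\left(\sigma\,\mathrm{mex}(n)+2\sum_{j=1}^{k}(-1)^j\,\sigma\,\mathrm{mex}(n-j^2)-\delta'(n)\right)=\sum_{j=-\infty}^{\infty}(-1)^j\,\overline{M}_k\big(n-j(3j-1)\big).$$
   Context: For a partition $\lambda$, $\mathrm{mex}(\lambda)$ is the smallest positive integer that is not a part of $\lambda$ (the empty partition has mex $1$). For an integer $m\geqslant 0$, $\sigma\,\mathrm{mex}(m)$ is the sum of $\mathrm{mex}(\lambda)$ over all partitions $\lambda$ of $m$; $\sigma\,\mathrm{mex}(m)=0$ for $m<0$. $\delta'(n)=(-1)^m$ if $n=m(3m-1)$ for some integer $m$, and $\delta'(n)=0$ otherwise. An overpartition is a partition in which the first occurrence of each distinct part value may be overlined or not. $\overline{M}_k(m)$ is the number of overpartitions of $m$ in which the first (i.e. smallest) part larger than $k$ appears at least $k+1$ times (such a part must exist); $\overline{M}_k(m)=0$ for $m<0$. *)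

theory Defs
  imports "HOL-Library.Multiset" "HOL-Analysis.Infinite_Sum"
begin

text \<open>Partitions are multisets of positive parts.\<close>

definition partitions :: "nat \<Rightarrow> nat multiset set" where
  "partitions n = {p. 0 \<notin># p \<and> sum_mset p = n}"

definition mex :: "nat multiset \<Rightarrow> nat" where
  "mex p = (LEAST i. 0 < i \<and> i \<notin># p)"

definition sigma_mex :: "int \<Rightarrow> int" where
  "sigma_mex m = (if m < 0 then 0 else int (\<Sum>p\<in>partitions (nat m). mex p))"

text \<open>
  An overpartition is a pair of a partition and the set of those part values whose first
  occurrence is overlined. Overlined and non-overlined occurrences both count towards the
  multiplicity of a part value.
\<close>

definition overpartitions :: "nat \<Rightarrow> (nat multiset \<times> nat set) set" where
  "overpartitions n = {(p, S). p \<in> partitions n \<and> S \<subseteq> set_mset p}"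

definition Mbar :: "nat \<Rightarrow> int \<Rightarrow> int" where
  "Mbar k m = (if m < 0 then 0 else
     int (card {(p, S) \<in> overpartitions (nat m).
       \<exists>s. s \<in># p \<and> k < s \<and> (\<forall>t. t \<in># p \<and> k < t \<longrightarrow> s \<le> t) \<and> k + 1 \<le> count p s}))"

text \<open>The witness in the definition of \<open>delta'\<close> is unique, see \<open>delta'_eq\<close> below.\<close>

definition delta' :: "int \<Rightarrow> int" where
  "delta' n = (if \<exists>m::int. n = m * (3 * m - 1)
     then (-1) ^ nat \<bar>THE m::int. n = m * (3 * m - 1)\<bar> else 0)"

lemma pentagonal_inj:
  fixes a b :: int
  assumes "a * (3 * a - 1) = b * (3 * b - 1)"
  shows "a = b"
proof -
  have "(a - b) * (3 * (a + b) - 1) = 0"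
    using assms by (simp add: algebra_simps)
  moreover have "3 * (a + b) - 1 \<noteq> 0"
    by presburger
  ultimately show ?thesis by simp
qed

lemma delta'_eq: "delta' (m * (3 * m - 1)) = (-1) ^ nat \<bar>m\<bar>"
proof -
  have "(THE m'. m * (3 * m - 1) = m' * (3 * m' - 1)) = m"
    by (rule the_equality) (auto dest: pentagonal_inj)
  then show ?thesis
    unfolding delta'_def by (subst if_P) auto
qed

lemma finite_partitions: "finite (partitions n)"
proof -
  have "p \<in> mset ` {xs. set xs \<subseteq> {..n} \<and> length xs \<le> n}" if "p \<in> partitions n" for p
  proof -
    have p: "0 \<notin># p" "sum_mset p = n"
      using that by (auto simp: partitions_def)
    have *: "0 \<notin># q \<Longrightarrow> size q \<le> sum_mset q" for q :: "nat multiset"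
      by (induction q) auto
    obtain xs where xs: "mset xs = p"
      using ex_mset by blast
    have "length xs \<le> n"
      using *[OF p(1)] p(2) xs by (metis size_mset)
    moreover have "set xs \<subseteq> {..n}"
    proof
      fix x assume "x \<in> set xs"
      then have "x \<in># p" using xs by auto
      then show "x \<in> {..n}"
        using p(2) by (metis atMost_iff le_add1 multi_member_split sum_mset.add_mset)
    qed
    ultimately show ?thesis using xs by blast
  qed
  then have "partitions n \<subseteq> mset ` {xs. set xs \<subseteq> {..n} \<and> length xs \<le> n}"
    by blast
  moreover have "finite {xs. set xs \<subseteq> {..n} \<and> length xs \<le> n}"
    by (rule finite_lists_length_le) simp
  ultimately show ?thesis
    by (meson finite_imageI finite_subset)
qed

lemma finite_overpartitions: "finite (overpartitions n)"
proof -
  have "overpartitions n = (SIGMA p:partitions n. Pow (set_mset p))"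
    by (auto simp: overpartitions_def)
  then show ?thesis
    by (simp add: finite_partitions finite_SigmaI)
qed

end

theory Submission
  imports Defs "HOL-Computational_Algebra.Formal_Power_Series"
begin

text \<open>
  Write \<open>P = (-q; q) / (q; q)\<close> for the generating function of overpartitions, \<open>M\<^sub>k\<close> for that of
  \<open>Mbar k\<close> and \<open>E = (q\<^sup>2; q\<^sup>2)\<close>, all products being infinite. Summing over the smallest part
  exceeding \<open>k\<close> writes \<open>M\<^sub>k\<close> as a series, and a telescoping in that part shows
  \<open>M\<^sub>k + M\<^sub>k\<^sub>-\<^sub>1 = 2 q\<^bsup>k^2\<^esup> P\<close>. With \<open>M\<^sub>0 = P - 1\<close> this yields
  \<open>(-1)\<^sup>k M\<^sub>k = P (1 + 2 \<Sum>\<^bsub>j\<le>k\<^esub> (-1)\<^sup>j q\<^bsup>j^2\<^esup>) - 1\<close>, which is multiplied by \<open>E\<close>. Since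
  \<open>mex p\<close> counts the \<open>m \<ge> 0\<close> such that \<open>1, \<dots>, m\<close> are all parts of \<open>p\<close>, the generating function
  of \<open>sigma_mex\<close> is \<open>(\<Sum>m. q\<^bsup>m(m+1)/2\<^esup>) / (q; q)\<close>, which by identities of Gauss and Euler equals
  \<open>(-q; q)\<^sup>2 = E P\<close>, and by the pentagonal number theorem \<open>E = \<Sum>j. (-1)\<^sup>j q\<^bsup>j(3j-1)\<^esup>\<close>.
  Infinite products and series are replaced by finite ones agreeing with them up to a given degree.
\<close>

section \<open>Generating functions\<close>

unbundle fps_syntax

text \<open>The factor of one part size \<open>a\<close>: multiplicity \<open>c\<close> has weight
  \<open>f c\<close> and degree \<open>a * c\<close>. Weighted counts of partitions become products
  of such factors.\<close>

definition part_series :: "nat \<Rightarrow> (nat \<Rightarrow> 'a) \<Rightarrow> 'a::comm_ring_1 fps" where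
  "part_series a f = Abs_fps (\<lambda>n. if a dvd n then f (n div a) else 0)"

abbreviation geo :: "nat \<Rightarrow> 'a::comm_ring_1 fps" where
  "geo a \<equiv> part_series a (\<lambda>_. 1)"

lemma part_series_nth: "part_series a f $ n = (if a dvd n then f (n div a) else 0)"
  by (simp add: part_series_def)

lemma part_series_zero_only: "a > 0 \<Longrightarrow> part_series a (\<lambda>c. if c = 0 then 1 else 0) = 1"
  by (rule fps_ext) (auto simp: part_series_nth elim!: dvdE)

lemma part_series_at_least:
  assumes "a > 0"
  shows "part_series a (\<lambda>c. if r \<le> c then w else 0) = fps_const w * fps_X ^ (r * a) * geo a"
proof (rule fps_ext)
  fix n
  have *: "(fps_const w * fps_X ^ (r * a) * geo a) $ n = w * (if n < r * a then 0 else geo a $ (n - r * a))"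
    by (simp add: mult.assoc fps_X_power_mult_nth)
  show "part_series a (\<lambda>c. if r \<le> c then w else 0) $ n = (fps_const w * fps_X ^ (r * a) * geo a) $ n"
  proof (cases "n < r * a")
    case True
    then have "n div a < r" using assms by (simp add: div_less_iff_less_mult)
    with True show ?thesis unfolding * by (auto simp: part_series_nth)
  next
    case False
    then have "r \<le> n div a" using assms by (simp add: less_eq_div_iff_mult_less_eq)
    moreover from False have "a dvd n - r * a \<longleftrightarrow> a dvd n"
      by (metis dvd_diff_nat dvd_diffD dvd_triv_right not_less)
    ultimately show ?thesis using False unfolding * by (auto simp: part_series_nth)
  qed
qed

lemma geo_unfold:
  assumes "a > 0"
  shows "geo a = 1 + fps_X ^ a * geo a"
proof -
  have "geo a = part_series a (\<lambda>c. if c = 0 then 1 else 0) + part_series a (\<lambda>c. if 1 \<le> c then 1 else 0)"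
    by (rule fps_ext) (auto simp: part_series_nth)
  then show ?thesis
    using assms by (simp only: part_series_zero_only part_series_at_least) simp
qed

lemma geo_mult: "a > 0 \<Longrightarrow> (1 - fps_X ^ a) * geo a = 1"
  using geo_unfold[of a] by (simp add: algebra_simps)

lemma part_series_overlined:
  assumes "a > 0"
  shows "part_series a (\<lambda>c. if c = 0 then 1 else 2) = (1 + fps_X ^ a) * geo a"
proof -
  have "part_series a (\<lambda>c. if c = 0 then 1 else 2) = geo a + part_series a (\<lambda>c. if 1 \<le> c then 1 else 0)"
    by (rule fps_ext) (auto simp: part_series_nth)
  then show ?thesis
    using assms by (simp only: part_series_at_least) (simp add: algebra_simps)
qed

text \<open>A multiset with parts in \<open>insert a A\<close> splits into its copies of
  \<open>a\<close>, of total size \<open>i\<close>, and a multiset over \<open>A\<close> with sum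
  \<open>n - i\<close>, which is the Cauchy product. Excluding the part 0 keeps the sets of
  multisets finite.\<close>

lemma prod_part_series_nth:
  fixes f :: "nat \<Rightarrow> nat \<Rightarrow> 'a::comm_ring_1"
  assumes "finite A" "0 \<notin> A"
  shows "(\<Prod>a\<in>A. part_series a (f a)) $ n =
    (\<Sum>p | set_mset p \<subseteq> A \<and> sum_mset p = n. \<Prod>a\<in>A. f a (count p a))"
  using assms
proof (induction A arbitrary: n rule: finite_induct)
  case empty
  have "{p :: nat multiset. p = {#} \<and> sum_mset p = n} = (if n = 0 then {{#}} else {})" by auto
  then show ?case by (simp add: fps_one_nth cong: conj_cong)
next
  case (insert a A)
  let ?P = "\<lambda>n. {p. set_mset p \<subseteq> A \<and> sum_mset p = n}"
  let ?Q = "{p. set_mset p \<subseteq> insert a A \<and> sum_mset p = n}"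
  let ?g = "\<lambda>p. \<Prod>b\<in>A. f b (count p b)"
  from insert have "a > 0" by auto
  have fin: "finite (?P m)" for m
    by (rule finite_subset[OF _ finite_partitions[of m]]) (use insert.prems in \<open>auto simp: partitions_def\<close>)
  have a: "count p a = 0" if "set_mset p \<subseteq> A" for p
    using that insert.hyps by (meson not_in_iff subsetD)
  have "(\<Sum>p\<in>?Q. \<Prod>b\<in>insert a A. f b (count p b)) =
      (\<Sum>(i, p)\<in>(SIGMA i:{i\<in>{..n}. a dvd i}. ?P (n - i)). f a (i div a) * ?g p)"
  proof (rule sum.reindex_bij_witness[of _ "\<lambda>(i, p). p + replicate_mset (i div a) a"
        "\<lambda>p. (count p a * a, filter_mset (\<lambda>x. x \<noteq> a) p)"])
    fix p assume p: "p \<in> ?Q"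
    show eq: "(case (count p a * a, filter_mset (\<lambda>x. x \<noteq> a) p) of
       (i, p) \<Rightarrow> p + replicate_mset (i div a) a) = p"
      using \<open>a > 0\<close> by (auto simp: multiset_eq_iff)
    have "sum_mset (filter_mset (\<lambda>x. x \<noteq> a) p + replicate_mset (count p a) a) = n"
      using p eq \<open>a > 0\<close> by simp
    then show "(count p a * a, filter_mset (\<lambda>x. x \<noteq> a) p) \<in> (SIGMA i:{i\<in>{..n}. a dvd i}. ?P (n - i))"
      using p by (auto simp: sum_mset_replicate_mset)
    have "?g (filter_mset (\<lambda>x. x \<noteq> a) p) = ?g p"
      using insert.hyps by (intro prod.cong) auto
    then show "(case (count p a * a, filter_mset (\<lambda>x. x \<noteq> a) p) of (i, p) \<Rightarrow> f a (i div a) * ?g p)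
        = (\<Prod>b\<in>insert a A. f b (count p b))"
      using insert.hyps \<open>a > 0\<close> by simp
  next
    fix x assume x: "x \<in> (SIGMA i:{i\<in>{..n}. a dvd i}. ?P (n - i))"
    then obtain i p where ip: "x = (i, p)" "i \<le> n" "a dvd i" "set_mset p \<subseteq> A" "sum_mset p = n - i"
      by auto
    show "(count (case x of (i, p) \<Rightarrow> p + replicate_mset (i div a) a) a * a,
        filter_mset (\<lambda>x. x \<noteq> a) (case x of (i, p) \<Rightarrow> p + replicate_mset (i div a) a)) = x"
      using ip a[OF ip(4)] by (auto simp: multiset_eq_iff)
    show "(case x of (i, p) \<Rightarrow> p + replicate_mset (i div a) a) \<in> ?Q"
      using ip by (auto simp: sum_mset_replicate_mset split: if_splits)
  qed
  also have "\<dots> = (\<Sum>i | i \<le> n \<and> a dvd i. f a (i div a) * (\<Prod>a\<in>A. part_series a (f a)) $ (n - i))"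
    using fin insert by (subst sum.Sigma[symmetric]) (auto simp: sum_distrib_left)
  also have "\<dots> = (\<Sum>i = 0..n. part_series a (f a) $ i * (\<Prod>a\<in>A. part_series a (f a)) $ (n - i))"
    by (intro sum.mono_neutral_cong_left) (auto simp: part_series_nth)
  also have "\<dots> = (\<Prod>a\<in>insert a A. part_series a (f a)) $ n"
    using insert.hyps by (simp add: fps_mult_nth)
  finally show ?case by simp
qed

text \<open>No part of a partition of \<open>n\<close> exceeds \<open>N\<close>, so the truncated
  product already has the coefficients of the infinite one up to degree \<open>N\<close>.\<close>

lemma prod_part_series_nth_partitions:
  fixes f :: "nat \<Rightarrow> nat \<Rightarrow> 'a::comm_ring_1"
  assumes "n \<le> N"
  shows "(\<Prod>a=1..N. part_series a (f a)) $ n = (\<Sum>p\<in>partitions n. \<Prod>a=1..N. f a (count p a))"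
proof -
  have "x \<le> N" if "x \<in># p" "sum_mset p = n" for x p
    using that assms by (metis le_add1 le_trans multi_member_split sum_mset.add_mset)
  then have "{p. set_mset p \<subseteq> {1..N} \<and> sum_mset p = n} = partitions n"
    by (fastforce simp: partitions_def Suc_le_eq intro: gr0I)
  then show ?thesis by (subst prod_part_series_nth) auto
qed

lemma mem_partitions_le: "p \<in> partitions n \<Longrightarrow> x \<in># p \<Longrightarrow> 0 < x \<and> x \<le> n"
  unfolding partitions_def
  by (metis (mono_tags, lifting) gr0I le_add1 mem_Collect_eq multi_member_split sum_mset.add_mset)

lemma prod_split_interval:
  fixes g :: "nat \<Rightarrow> 'a::comm_monoid_mult"
  assumes "l \<le> Suc m" "m \<le> n"
  shows "prod g {l..n} = prod g {l..m} * prod g {Suc m..n}"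
proof -
  have "{l..n} = {l..m} \<union> {Suc m..n}" using assms by auto
  then show ?thesis by (simp add: prod.union_disjoint)
qed

section \<open>The generating function of \<open>sigma_mex\<close>\<close>

lemma less_mex_iff: "m < mex p \<longleftrightarrow> (\<forall>i\<in>{1..m}. i \<in># p)"
proof -
  \<comment> \<open>A multiset has finite support, so some positive value is missing and the
    \<open>LEAST\<close> in \<open>mex\<close> is attained.\<close>
  obtain j where j: "0 < j" "j \<notin># p"
    using infinite_nat_iff_unbounded[of "UNIV - set_mset p"] by (auto simp: Diff_infinite_finite)
  have mex: "0 < mex p \<and> mex p \<notin># p"
    unfolding mex_def by (rule LeastI[of _ j]) (use j in auto)
  show ?thesis
  proof
    assume "m < mex p"
    then have "\<not> (0 < i \<and> i \<notin># p)" if "i \<le> m" for i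
      unfolding mex_def using that by (intro not_less_Least) simp
    then show "\<forall>i\<in>{1..m}. i \<in># p" by (metis atLeastAtMost_iff zero_less_one order.strict_trans2)
  next
    assume "\<forall>i\<in>{1..m}. i \<in># p"
    then have "mex p \<notin> {1..m}" using mex by blast
    then show "m < mex p" using mex by simp
  qed
qed

lemma mex_le:
  assumes "p \<in> partitions n"
  shows "mex p \<le> Suc n"
  using less_mex_iff[of "Suc n" p] mem_partitions_le[OF assms, of "Suc n"] by force

lemma mex_eq_sum:
  assumes "p \<in> partitions n" "n \<le> N"
  shows "int (mex p) = (\<Sum>m=0..N. if \<forall>i\<in>{1..m}. i \<in># p then 1 else 0)"
proof -
  have "{m \<in> {0..N}. m < mex p} = {..<mex p}"
    using mex_le[OF assms(1)] assms(2) by auto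
  then have "int (mex p) = (\<Sum>m\<in>{m \<in> {0..N}. m < mex p}. 1)" by simp
  also have "\<dots> = (\<Sum>m=0..N. if m < mex p then 1 else 0)"
    by (subst sum.inter_filter) auto
  finally show ?thesis by (simp only: less_mex_iff)
qed

abbreviation geo_prod :: "nat \<Rightarrow> int fps" where
  "geo_prod N \<equiv> (\<Prod>i=1..N. geo i)"

text \<open>For fixed \<open>m\<close>, the partitions containing all of \<open>1, ..., m\<close>
  arise by adding one copy of each of these to an arbitrary partition, hence the factor
  \<open>fps_X ^ (\<Sum>{1..m})\<close>. Summing over \<open>m\<close> gives the mex by
  \<open>mex_eq_sum\<close>.\<close>

lemma sigma_mex_nth:
  assumes "n \<le> N"
  shows "sigma_mex (int n) = ((\<Sum>m=0..N. fps_X ^ (\<Sum>{1..m})) * geo_prod N) $ n"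
proof -
  have *: "fps_X ^ (\<Sum>{1..m}) * geo_prod N =
      (\<Prod>i=1..N. part_series i (\<lambda>c. if (i \<le> m \<longrightarrow> 0 < c) then 1 else 0))" if "m \<le> N" for m
  proof -
    have "(\<Prod>i=1..N. part_series i (\<lambda>c. if (i \<le> m \<longrightarrow> 0 < c) then 1 else 0)) =
        (\<Prod>i=1..N. (if i \<le> m then fps_X ^ i else 1) * geo i :: int fps)"
      using part_series_at_least[of _ 1 "1::int"]
      by (intro prod.cong) (auto simp: Suc_le_eq)
    also have "\<dots> = (\<Prod>i=1..N. if i \<le> m then fps_X ^ i else 1) * geo_prod N"
      by (simp add: prod.distrib)
    also have "(\<Prod>i=1..N. if i \<le> m then fps_X ^ i else 1) = (\<Prod>i=1..m. fps_X ^ i :: int fps)"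
      using that by (intro prod.mono_neutral_cong_right) auto
    finally show ?thesis by (simp add: power_sum)
  qed
  have "sigma_mex (int n) = (\<Sum>p\<in>partitions n. int (mex p))"
    by (simp add: sigma_mex_def)
  also have "\<dots> = (\<Sum>p\<in>partitions n. \<Sum>m=0..N. if \<forall>i\<in>{1..m}. i \<in># p then 1 else 0)"
    using assms by (intro sum.cong) (auto simp: mex_eq_sum)
  also have "\<dots> = (\<Sum>m=0..N. \<Sum>p\<in>partitions n. if \<forall>i\<in>{1..m}. i \<in># p then 1 else 0)"
    by (rule sum.swap)
  also have "\<dots> = (\<Sum>m=0..N. \<Sum>p\<in>partitions n. \<Prod>i=1..N. if (i \<le> m \<longrightarrow> 0 < count p i) then 1 else 0)"
  proof (intro sum.cong refl)
    fix m p assume "m \<in> {0..N}"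
    then show "(if \<forall>i\<in>{1..m}. i \<in># p then 1 else 0) =
        (\<Prod>i=1..N. if (i \<le> m \<longrightarrow> 0 < count p i) then 1 else 0 :: int)"
      by (auto simp: prod_zero_iff Ball_def count_eq_zero_iff[symmetric] split: if_splits)
  qed
  also have "\<dots> = (\<Sum>m=0..N. (fps_X ^ (\<Sum>{1..m}) * geo_prod N) $ n)"
    using assms by (intro sum.cong refl) (simp only: * atLeastAtMost_iff prod_part_series_nth_partitions)
  finally show ?thesis
    by (simp add: sum_distrib_right fps_sum_nth)
qed

section \<open>The generating function of \<open>Mbar k\<close>\<close>

abbreviation overp :: "nat \<Rightarrow> int fps" where
  "overp i \<equiv> (1 + fps_X ^ i) * geo i"

text \<open>The summand \<open>s\<close> collects the overpartitions whose smallest part above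
  \<open>k\<close> is \<open>s\<close>: at least \<open>k + 1\<close> copies of \<open>s\<close>
  with 2 choices of overlining, no part strictly between \<open>k\<close> and \<open>s\<close>, and
  all other parts free, with factor \<open>overp i\<close>.\<close>

definition Mbar_series :: "nat \<Rightarrow> nat \<Rightarrow> int fps" where
  "Mbar_series k N = (\<Sum>s=k+1..N. 2 * fps_X ^ ((k+1) * s) * (\<Prod>i=1..k. overp i) * geo s * (\<Prod>i=s+1..N. overp i))"

lemma Mbar_nth:
  assumes "n \<le> N"
  shows "Mbar k (int n) = Mbar_series k N $ n"
proof -
  \<comment> \<open>The multiplicity weights for a fixed \<open>s\<close>. Their product over all
    part sizes is the number of overlinings if \<open>first s p\<close> holds, and 0 otherwise
    (\<open>wt\<close> below).\<close>
  define f :: "nat \<Rightarrow> nat \<Rightarrow> nat \<Rightarrow> int" where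
    "f s i c = (if k < i \<and> i < s then (if c = 0 then 1 else 0)
       else if i = s then (if k + 1 \<le> c then 2 else 0)
       else (if c = 0 then 1 else 2))" for s i c
  define first where
    "first s p \<longleftrightarrow> s \<in># p \<and> k < s \<and> (\<forall>t. t \<in># p \<and> k < t \<longrightarrow> s \<le> t) \<and> k + 1 \<le> count p s" for s and p :: "nat multiset"
  have f_over: "f s i = (\<lambda>c. if c = 0 then 1 else 2)" if "k < s" "i \<le> k \<or> s < i" for s i
    using that by (auto simp: f_def)
  have f_gap: "f s i = (\<lambda>c. if c = 0 then 1 else 0)" if "k < i" "i < s" for s i
    using that by (auto simp: f_def)
  have f_first: "f s s = (\<lambda>c. if k + 1 \<le> c then 2 else 0)" for s
    by (auto simp: f_def)
  have ser: "(\<Prod>i=1..N. part_series i (f s i)) =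
      2 * fps_X ^ ((k+1) * s) * (\<Prod>i=1..k. overp i) * geo s * (\<Prod>i=s+1..N. overp i)"
    if "s \<in> {k+1..N}" for s
  proof -
    have 1: "(\<Prod>i=1..k. part_series i (f s i)) = (\<Prod>i=1..k. overp i)"
      using that by (intro prod.cong) (auto simp: f_over part_series_overlined)
    have 2: "(\<Prod>i=k+1..s-1. part_series i (f s i)) = 1"
      by (intro prod.neutral) (auto simp: f_gap part_series_zero_only)
    have 3: "part_series s (f s s) = 2 * fps_X ^ ((k+1) * s) * geo s"
      using that part_series_at_least[of s "k+1" "2::int"]
      by (simp add: f_first numeral_fps_const)
    have 4: "(\<Prod>i=s+1..N. part_series i (f s i)) = (\<Prod>i=s+1..N. overp i)"
      using that by (intro prod.cong) (auto simp: f_over part_series_overlined)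
    have "prod g {1..N} = prod g {1..k} * (prod g {k+1..s-1} * (g s * prod g {s+1..N}))" for g :: "nat \<Rightarrow> int fps"
      using that prod_split_interval[of 1 k N g] prod_split_interval[of "k+1" "s-1" N g]
        prod.atLeast_Suc_atMost[of s N g] le_trans[OF diff_le_self[of s 1], of N]
      by (simp add: mult.assoc)
    note this[of "\<lambda>i. part_series i (f s i)"]
    then show ?thesis unfolding 1 2 3 4 by (simp only: mult_ac mult_1_left)
  qed
  have wt: "(\<Prod>i=1..N. f s i (count p i)) = (if first s p then 2 ^ card (set_mset p) else 0)"
    if s: "s \<in> {k+1..N}" and p: "p \<in> partitions n" for s p
  proof (cases "first s p")
    case True
    have "(\<Prod>i=1..N. f s i (count p i)) = (\<Prod>i=1..N. if i \<in># p then 2 else 1)"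
    proof (intro prod.cong refl)
      fix i
      show "f s i (count p i) = (if i \<in># p then 2 else 1)"
        using True count_eq_zero_iff[of p i] by (auto simp: f_def first_def not_le)
    qed
    also have "\<dots> = (\<Prod>i\<in>set_mset p. 2)"
      using mem_partitions_le[OF p] assms by (intro prod.mono_neutral_cong_right) force+
    finally show ?thesis using True by simp
  next
    case False
    then have "(\<exists>t. t \<in># p \<and> k < t \<and> t < s) \<or> count p s \<le> k"
      using s count_eq_zero_iff[of p s] by (force simp: first_def not_le)
    then have "\<exists>i\<in>{1..N}. f s i (count p i) = 0"
    proof
      assume "\<exists>t. t \<in># p \<and> k < t \<and> t < s"
      then obtain t where "t \<in># p" "k < t" "t < s" by blast
      then show ?thesis using s by (intro bexI[of _ t]) (auto simp: f_def)
    next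
      assume "count p s \<le> k"
      then show ?thesis using s by (intro bexI[of _ s]) (auto simp: f_def)
    qed
    then show ?thesis using False by (simp add: prod_zero)
  qed
  \<comment> \<open>The smallest part above \<open>k\<close> is unique, so at most one
    \<open>s\<close> contributes.\<close>
  have uniq: "(\<Sum>s=k+1..N. if first s p then c else 0) = (if \<exists>s. first s p then c else 0)"
    if p: "p \<in> partitions n" for p and c :: int
  proof (cases "\<exists>s. first s p")
    case True
    then obtain s where s: "first s p" by blast
    then have "s \<in> {k+1..N}" using mem_partitions_le[OF p, of s] assms by (auto simp: first_def)
    moreover have "first t p \<longleftrightarrow> t = s" for t
      using s unfolding first_def by (metis order_antisym)
    ultimately show ?thesis by simp
  qed auto
  have "{(p, S) \<in> overpartitions n. \<exists>s. first s p} =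
      (SIGMA p:{p\<in>partitions n. \<exists>s. first s p}. Pow (set_mset p))"
    by (auto simp: overpartitions_def)
  then have "card {(p, S) \<in> overpartitions n. \<exists>s. first s p} =
      (\<Sum>p | p \<in> partitions n \<and> (\<exists>s. first s p). 2 ^ card (set_mset p))"
    by (simp add: card_SigmaI finite_partitions card_Pow)
  moreover have "Mbar k (int n) = int (card {(p, S) \<in> overpartitions n. \<exists>s. first s p})"
    by (simp add: Mbar_def first_def)
  ultimately have "Mbar k (int n) = (\<Sum>p | p \<in> partitions n \<and> (\<exists>s. first s p). 2 ^ card (set_mset p))"
    by simp
  also have "\<dots> = (\<Sum>p\<in>partitions n. if \<exists>s. first s p then 2 ^ card (set_mset p) else 0)"
    by (rule sum.inter_filter[OF finite_partitions])
  also have "\<dots> = (\<Sum>p\<in>partitions n. \<Sum>s=k+1..N. \<Prod>i=1..N. f s i (count p i))"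
    by (intro sum.cong refl) (simp only: uniq[symmetric] wt cong: sum.cong)
  also have "\<dots> = (\<Sum>s=k+1..N. \<Sum>p\<in>partitions n. \<Prod>i=1..N. f s i (count p i))"
    by (rule sum.swap)
  also have "\<dots> = Mbar_series k N $ n"
    unfolding Mbar_series_def fps_sum_nth
    by (intro sum.cong refl) (simp only: ser[symmetric] prod_part_series_nth_partitions[OF assms])
  finally show ?thesis .
qed

section \<open>The recurrence of \<open>Mbar_series\<close> in \<open>k\<close>\<close>

lemma atLeastAtMost_Suc_right: "s \<le> N \<Longrightarrow> {s..N} = insert s {Suc s..N}"
  by auto

text \<open>For \<open>k = 0\<close> every nonempty overpartition qualifies. Formally,
  \<open>overp s - 1 = 2 * fps_X ^ s * geo s\<close> turns the summands into differences of the tail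
  products \<open>R s\<close>.\<close>

lemma Mbar_series_0: "Mbar_series 0 N = (\<Prod>i=1..N. overp i) - 1"
proof -
  define R where "R s = (\<Prod>i=s..N. overp i)" for s
  have "2 * fps_X ^ s * geo s * R (Suc s) = R s - R (Suc s)" if "s \<in> {1..N}" for s
  proof -
    have R: "R s = overp s * R (Suc s)"
      using that by (simp add: R_def atLeastAtMost_Suc_right)
    have "R (Suc s) = (1 - fps_X ^ s) * geo s * R (Suc s)"
      using that by (simp add: geo_mult)
    with R show ?thesis by (simp add: algebra_simps)
  qed
  then have "Mbar_series 0 N = (\<Sum>s=1..N. R s - R (Suc s))"
    unfolding Mbar_series_def by (intro sum.cong) (auto simp: R_def)
  also have "\<dots> = R 1 - R (Suc N)"
    using sum_Suc_diff[of 1 N R] by (simp add: sum_subtractf algebra_simps)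
  finally show ?thesis by (simp add: R_def)
qed

text \<open>
  Apart from the term \<open>s = k + 1\<close> of \<open>Mbar_series k N\<close>, adding the two series termwise gives
  \<open>2 * (H s - H (Suc s))\<close>, with \<open>H\<close> as in the proof.
\<close>

lemma Mbar_series_Suc:
  assumes "k < N"
  shows "\<exists>r. Mbar_series (Suc k) N + Mbar_series k N =
    2 * fps_X ^ (Suc k)\<^sup>2 * (\<Prod>i=1..N. overp i) + fps_X ^ Suc N * r"
proof -
  let ?k = "Suc k"
  define R where "R s = (\<Prod>i=s..N. overp i)" for s
  \<comment> \<open>The products of \<open>overp i\<close> up to \<open>k\<close> and up to
    \<open>Suc k\<close> are both polynomial multiples of \<open>C\<close>, by the factors
    \<open>1 - fps_X ^ ?k\<close> and \<open>1 + fps_X ^ ?k\<close>.\<close>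
  define C where "C = (\<Prod>i=1..k. overp i) * geo ?k"
  define H where "H s = fps_X ^ (?k * s) * C * R s" for s
  define t where "t j s = 2 * fps_X ^ ((j+1) * s) * (\<Prod>i=1..j. overp i) * geo s * (\<Prod>i=s+1..N. overp i)" for j s
  have R: "R s = overp s * R (Suc s)" if "s \<le> N" for s
    using that by (simp add: R_def atLeastAtMost_Suc_right)
  have C: "(\<Prod>i=1..k. overp i) = (1 - fps_X ^ ?k) * C"
    using geo_mult[of ?k, where 'a = int] by (simp only: C_def mult.left_commute) simp
  have C': "(\<Prod>i=1..?k. overp i) = (1 + fps_X ^ ?k) * C"
    by (simp add: C_def mult_ac)
  have step: "t ?k s + t k s = 2 * (H s - H (Suc s))" if "s \<in> {?k+1..N}" for s
  proof -
    \<comment> \<open>Inserting this 1 into \<open>H (Suc s)\<close> gives all four terms the common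
      factor \<open>C * geo s * R (Suc s)\<close>; a polynomial identity remains.\<close>
    have g: "(1 - fps_X ^ s) * geo s = (1 :: int fps)" using that by (simp add: geo_mult)
    have "H s = fps_X ^ (?k * s) * C * (1 + fps_X ^ s) * geo s * R (Suc s)"
      using that R[of s] by (simp add: H_def mult_ac)
    moreover have "H (Suc s) = fps_X ^ (?k * s) * fps_X ^ ?k * C * ((1 - fps_X ^ s) * geo s) * R (Suc s)"
      unfolding g by (simp add: H_def power_add[symmetric] add_ac)
    moreover have "t ?k s = 2 * (fps_X ^ (?k * s) * fps_X ^ s) * ((1 + fps_X ^ ?k) * C) * geo s * R (Suc s)"
      unfolding t_def C' by (simp add: R_def power_add[symmetric] add_ac)
    moreover have "t k s = 2 * fps_X ^ (?k * s) * ((1 - fps_X ^ ?k) * C) * geo s * R (Suc s)"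
      unfolding t_def C by (simp add: R_def)
    ultimately show ?thesis by (simp only:) (simp add: algebra_simps)
  qed
  \<comment> \<open>The unpaired first summand and the lower boundary value of the telescoping
    combine to the theta term.\<close>
  have "t k ?k + 2 * H (Suc ?k) = 2 * fps_X ^ ?k\<^sup>2 * (\<Prod>i=1..N. overp i)"
  proof -
    have "{1..N} = {1..k} \<union> {?k..N}" using assms by auto
    then have "(\<Prod>i=1..N. overp i) = (\<Prod>i=1..k. overp i) * R ?k"
      by (simp add: R_def prod.union_disjoint)
    also have "\<dots> = (\<Prod>i=1..k. overp i) * overp ?k * R (Suc ?k)"
      using assms R[of ?k] by (simp add: mult_ac)
    finally have P: "(\<Prod>i=1..N. overp i) = (1 + fps_X ^ ?k) * C * R (Suc ?k)"
      by (simp add: C_def mult_ac)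
    have "t k ?k = 2 * fps_X ^ ?k\<^sup>2 * C * R (Suc ?k)"
      by (simp add: t_def C_def R_def power2_eq_square mult_ac)
    moreover have "H (Suc ?k) = fps_X ^ ?k\<^sup>2 * fps_X ^ ?k * C * R (Suc ?k)"
      unfolding H_def by (simp add: power2_eq_square power_add[symmetric] add_ac)
    ultimately show ?thesis unfolding P by (simp only:) (simp add: algebra_simps)
  qed
  moreover have "Mbar_series k N = t k ?k + (\<Sum>s=?k+1..N. t k s)"
    using assms by (simp add: Mbar_series_def t_def atLeastAtMost_Suc_right)
  moreover have "(\<Sum>s=?k+1..N. t ?k s) + (\<Sum>s=?k+1..N. t k s) = 2 * (H (Suc ?k) - H (Suc N))"
  proof -
    have "(\<Sum>s=?k+1..N. t ?k s) + (\<Sum>s=?k+1..N. t k s) = 2 * (\<Sum>s=?k+1..N. H s - H (Suc s))"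
      unfolding sum.distrib[symmetric] sum_distrib_left using step by (intro sum.cong) auto
    also have "(\<Sum>s=?k+1..N. H s - H (Suc s)) = - (\<Sum>s=?k+1..N. H (Suc s) - H s)"
      by (simp only: sum_negf[symmetric] minus_diff_eq)
    also have "(\<Sum>s=?k+1..N. H (Suc s) - H s) = H (Suc N) - H (Suc ?k)"
      using assms by (subst sum_Suc_diff) auto
    finally show ?thesis by simp
  qed
  moreover have "Mbar_series ?k N = (\<Sum>s=?k+1..N. t ?k s)"
    by (simp add: Mbar_series_def t_def)
  \<comment> \<open>The upper boundary value is the truncation error, divisible by
    \<open>fps_X ^ Suc N\<close>; it supplies \<open>r\<close>.\<close>
  moreover have "H (Suc N) = fps_X ^ Suc N * (fps_X ^ (k * Suc N) * C)"
    by (simp add: H_def R_def power_add[symmetric] mult.assoc[symmetric])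
  ultimately have "Mbar_series ?k N + Mbar_series k N =
      2 * fps_X ^ ?k\<^sup>2 * (\<Prod>i=1..N. overp i) + fps_X ^ Suc N * (- 2 * (fps_X ^ (k * Suc N) * C))"
    by (simp add: algebra_simps)
  then show ?thesis by blast
qed

section \<open>Shanks's finite forms of Euler's and Gauss's identities\<close>

text \<open>
  Both are proved by induction on \<open>n\<close>: after factoring the new product factor out, the difference
  of the sums for \<open>Suc n\<close> and \<open>n\<close> telescopes in \<open>s\<close> through \<open>H\<close>. Only the term \<open>s = 0\<close> on
  the left has low degree in \<open>y\<close>.
\<close>

lemma pentagonal_finite:
  fixes y :: "'a::comm_ring_1"
  shows "(\<Sum>s=0..n. (-1) ^ s * (\<Prod>i=s+1..n. 1 - y ^ (2 * i)) * y ^ (2 * s * n + s * (s + 1))) =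
    1 + (\<Sum>j=1..n. (-1) ^ j * (y ^ (j * (3 * j - 1)) + y ^ (j * (3 * j + 1))))"
proof (induction n)
  case 0
  then show ?case by simp
next
  case (Suc n)
  define Q where "Q s = (\<Prod>i=s+1..n. 1 - y ^ (2 * i))" for s
  define H where "H s = (if s = 0 then 0 else (-1) ^ s * Q (s - 1) * y ^ (2 * s * n + s * (s + 1)))" for s
  have step: "(-1) ^ s * (Q s * (1 - y ^ (2 * Suc n))) * y ^ (2 * s * Suc n + s * (s + 1)) =
      (-1) ^ s * Q s * y ^ (2 * s * n + s * (s + 1)) + (H (Suc s) - H s)" if "s \<in> {0..n}" for s
  proof -
    define w where "w = y ^ (2 * s * n + s * (s + 1))"
    have 1: "y ^ (2 * s * Suc n + s * (s + 1)) = y ^ (2 * s) * w"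
      by (simp add: w_def power_add[symmetric] algebra_simps)
    have "y ^ (2 * Suc s * n + Suc s * (Suc s + 1)) = y ^ (2 * s) * y ^ (2 * Suc n) * w"
      by (simp add: w_def power_add[symmetric] algebra_simps)
    then have 2: "H (Suc s) = - ((-1) ^ s) * Q s * (y ^ (2 * s) * y ^ (2 * Suc n) * w)"
      by (simp add: H_def)
    \<comment> \<open>\<open>Q (s - 1)\<close> equals \<open>(1 - y ^ (2 * s)) * Q s\<close>. This
      factor vanishes at \<open>s = 0\<close>, in accordance with the value 0 of \<open>H\<close>
      there.\<close>
    have 3: "H s = (-1) ^ s * ((1 - y ^ (2 * s)) * Q s) * w"
      using that by (cases s) (simp_all add: H_def Q_def w_def atLeastAtMost_Suc_right)
    show ?thesis unfolding 1 2 3 w_def[symmetric] by (simp add: algebra_simps)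
  qed
  have Q: "(\<Prod>i=s+1..Suc n. 1 - y ^ (2 * i)) = Q s * (1 - y ^ (2 * Suc n))" if "s \<in> {0..n}" for s
    using that by (simp add: Q_def)
  \<comment> \<open>The summand \<open>s = Suc n\<close> is one of the two new pentagonal terms; the
    boundary value \<open>H (Suc n)\<close> is the other.\<close>
  have "(\<Sum>s=0..Suc n. (-1) ^ s * (\<Prod>i=s+1..Suc n. 1 - y ^ (2 * i)) * y ^ (2 * s * Suc n + s * (s + 1)))
      = (\<Sum>s=0..n. (-1) ^ s * (Q s * (1 - y ^ (2 * Suc n))) * y ^ (2 * s * Suc n + s * (s + 1)))
        + (-1) ^ Suc n * y ^ (Suc n * (3 * Suc n + 1))"
    unfolding sum.atLeast0_atMost_Suc
    by (intro arg_cong2[of _ _ _ _ "(+)"] sum.cong refl)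
       (simp_all only: Q, simp_all add: algebra_simps eval_nat_numeral)
  also have "(\<Sum>s=0..n. (-1) ^ s * (Q s * (1 - y ^ (2 * Suc n))) * y ^ (2 * s * Suc n + s * (s + 1)))
      = (\<Sum>s=0..n. (-1) ^ s * Q s * y ^ (2 * s * n + s * (s + 1))) + (\<Sum>s=0..n. H (Suc s) - H s)"
    unfolding sum.distrib[symmetric] using step by (intro sum.cong) auto
  also have "(\<Sum>s=0..n. H (Suc s) - H s) = (-1) ^ Suc n * y ^ (Suc n * (3 * Suc n - 1))"
    by (subst sum_Suc_diff) (auto simp: H_def Q_def algebra_simps)
  finally show ?case
    unfolding Q_def Suc.IH by (simp add: algebra_simps)
qed

text \<open>The sequence \<open>u\<close> of inverses keeps the identity meaningful in a ring without division.\<close>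

lemma gauss_triangular_finite:
  fixes y :: "'a::comm_ring_1" and u :: "nat \<Rightarrow> 'a"
  assumes u: "\<And>i. (1 - y ^ (2 * i + 1)) * u i = 1"
  shows "(\<Sum>s<n. (\<Prod>i=s..<n. (1 - y ^ (2 * i + 2)) * u i) * y ^ (s * (2 * n + 1))) = (\<Sum>j<2*n. y ^ (\<Sum>{1..j}))"
proof (induction n)
  case 0
  then show ?case by simp
next
  case (Suc n)
  define W where "W s = (\<Prod>i=s..<n. (1 - y ^ (2 * i + 2)) * u i)" for s
  define H where "H s = (if s = 0 then 0 else W (s - 1) * (1 - y ^ (2 * s - 1)) * y ^ (s * (2 * n + 1)))" for s
  have tri: "\<Sum>{1..2 * n} = n * (2 * n + 1)" "\<Sum>{1..Suc (2 * n)} = Suc n * (2 * n + 1)"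
    by (induction n) auto
  have step: "(\<Prod>i=s..<Suc n. (1 - y ^ (2 * i + 2)) * u i) * y ^ (s * (2 * Suc n + 1)) =
     W s * y ^ (s * (2 * n + 1)) + u n * (H (Suc s) - H s)" if "s < Suc n" for s
  proof -
    define w where "w = y ^ (s * (2 * n + 1))"
    have 1: "y ^ (s * (2 * Suc n + 1)) = y ^ (2 * s) * w"
      by (simp add: w_def power_add[symmetric] algebra_simps)
    have 2: "(\<Prod>i=s..<Suc n. (1 - y ^ (2 * i + 2)) * u i) = W s * ((1 - y * y ^ (2 * n + 1)) * u n)"
      using that by (simp add: W_def)
    have "y ^ (Suc s * (2 * n + 1)) = y ^ (2 * n + 1) * w"
      by (simp add: w_def power_add[symmetric] algebra_simps)
    then have 3: "H (Suc s) = W s * (1 - y * y ^ (2 * s)) * (y ^ (2 * n + 1) * w)"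
      by (simp add: H_def)
    \<comment> \<open>The factor \<open>1 - y ^ (2 * s - 1)\<close> of \<open>H s\<close> cancels
      the inverse \<open>u (s - 1)\<close> contained in \<open>W (s - 1)\<close>.\<close>
    have 4: "H s = (1 - y ^ (2 * s)) * W s * w"
    proof (cases s)
      case 0
      then show ?thesis by (simp add: H_def)
    next
      case (Suc r)
      then have "W r = (1 - y ^ (2 * s)) * u r * W s"
        using that by (simp add: W_def prod.atLeast_Suc_lessThan)
      then have "H s = (1 - y ^ (2 * s)) * W s * w * ((1 - y ^ (2 * r + 1)) * u r)"
        using Suc by (simp add: H_def w_def mult_ac)
      then show ?thesis unfolding u by simp
    qed
    \<comment> \<open>Used with \<open>Y = y ^ (2 * n + 1)\<close>, \<open>Z = y ^ (2 * s)\<close>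
      and \<open>U = u n\<close>: the two sides differ by a multiple of
      \<open>1 - (1 - Y) * U\<close>.\<close>
    have ring: "W s * ((1 - y * Y) * U) * (Z * w) = W s * w + U * (W s * (1 - y * Z) * (Y * w) - (1 - Z) * W s * w)"
      if "(1 - Y) * U = 1" for Y Z U
    proof -
      have "W s * w + U * (W s * (1 - y * Z) * (Y * w) - (1 - Z) * W s * w) - W s * ((1 - y * Y) * U) * (Z * w)
          = W s * w * (1 - (1 - Y) * U)"
        by (simp add: algebra_simps)
      then show ?thesis unfolding that by simp
    qed
    show ?thesis unfolding 1 2 3 4 w_def[symmetric] by (rule ring) (rule u)
  qed
  have "(\<Sum>s<Suc n. (\<Prod>i=s..<Suc n. (1 - y ^ (2 * i + 2)) * u i) * y ^ (s * (2 * Suc n + 1)))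
     = (\<Sum>s<Suc n. W s * y ^ (s * (2 * n + 1)) + u n * (H (Suc s) - H s))"
    using step by (intro sum.cong) auto
  also have "\<dots> = (\<Sum>s<Suc n. W s * y ^ (s * (2 * n + 1))) + u n * (\<Sum>s<Suc n. H (Suc s) - H s)"
    unfolding sum.distrib sum_distrib_left ..
  \<comment> \<open>Two triangular terms are new: \<open>j = 2 * n + 1\<close> is this boundary
    value, and \<open>j = 2 * n\<close> is the extra summand \<open>s = n\<close>, where
    \<open>W n = 1\<close>.\<close>
  also have "u n * (\<Sum>s<Suc n. H (Suc s) - H s) = y ^ \<Sum>{1..Suc (2 * n)}"
  proof -
    have "u n * (\<Sum>s<Suc n. H (Suc s) - H s) = ((1 - y ^ (2 * n + 1)) * u n) * y ^ (Suc n * (2 * n + 1))"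
      unfolding sum_lessThan_telescope by (simp add: H_def W_def mult_ac)
    then show ?thesis unfolding u tri by simp
  qed
  also have "(\<Sum>s<Suc n. W s * y ^ (s * (2 * n + 1))) = (\<Sum>j<2*n. y ^ (\<Sum>{1..j})) + y ^ \<Sum>{1..2 * n}"
    unfolding tri using Suc.IH by (simp add: W_def)
  finally show ?case by simp
qed

section \<open>Power series up to a given degree\<close>

text \<open>Congruence modulo \<open>fps_X ^ Suc n\<close>, hence compatible with the ring
  operations.\<close>

definition eq_upto :: "nat \<Rightarrow> 'a::comm_ring_1 fps \<Rightarrow> 'a fps \<Rightarrow> bool" where
  "eq_upto n f g \<longleftrightarrow> (\<forall>i\<le>n. f $ i = g $ i)"

lemma eq_upto_refl: "eq_upto n f f"
  and eq_upto_sym: "eq_upto n f g \<Longrightarrow> eq_upto n g f"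
  and eq_upto_trans [trans]: "eq_upto n f g \<Longrightarrow> eq_upto n g h \<Longrightarrow> eq_upto n f h"
  and eq_upto_add: "eq_upto n f g \<Longrightarrow> eq_upto n f' g' \<Longrightarrow> eq_upto n (f + f') (g + g')"
  and eq_upto_diff: "eq_upto n f g \<Longrightarrow> eq_upto n f' g' \<Longrightarrow> eq_upto n (f - f') (g - g')"
  by (simp_all add: eq_upto_def)

lemma eq_upto_mult: "eq_upto n f g \<Longrightarrow> eq_upto n f' g' \<Longrightarrow> eq_upto n (f * f') (g * g')"
  by (auto simp: eq_upto_def fps_mult_nth intro!: sum.cong)

lemma eq_upto_sum: "(\<And>i. i \<in> I \<Longrightarrow> eq_upto n (f i) (g i)) \<Longrightarrow> eq_upto n (sum f I) (sum g I)"
  by (simp add: eq_upto_def fps_sum_nth)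

lemma eq_upto_X_power: "n < m \<Longrightarrow> eq_upto n (f * fps_X ^ m) 0"
  by (simp add: eq_upto_def fps_X_power_mult_right_nth)

lemma eq_upto_prod_one: "(\<And>i. i \<in> I \<Longrightarrow> eq_upto n (f i) 1) \<Longrightarrow> eq_upto n (prod f I) 1"
proof (induction I rule: infinite_finite_induct)
  case (insert i I)
  then show ?case using eq_upto_mult[of n "f i" 1 "prod f I" 1] by simp
qed (auto simp: eq_upto_refl)

lemma eq_upto_first_term:
  fixes m :: nat
  assumes "\<And>s. s \<in> {0<..<m} \<Longrightarrow> eq_upto n (f s) 0" "m > 0"
  shows "eq_upto n (\<Sum>s<m. f s) (f 0)"
proof -
  have "{..<m} = insert 0 {0<..<m}" using assms(2) by auto
  then have "(\<Sum>s<m. f s) = f 0 + (\<Sum>s\<in>{0<..<m}. f s)" by simp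
  also have "eq_upto n \<dots> (f 0 + (\<Sum>s\<in>{0<..<m}. 0))"
    using assms by (intro eq_upto_add eq_upto_sum eq_upto_refl) auto
  finally show ?thesis by simp
qed

section \<open>Euler's and Gauss's identities up to a given degree\<close>

lemma sum_symmetric_interval:
  fixes f :: "int \<Rightarrow> 'a::comm_monoid_add"
  shows "(\<Sum>j\<in>{- int N..int N}. f j) = f 0 + (\<Sum>j=1..N. f (int j) + f (- int j))"
proof (induction N)
  case (Suc N)
  have "{- int (Suc N)..int (Suc N)} = insert (int (Suc N)) (insert (- int (Suc N)) {- int N..int N})"
    by auto
  then show ?case using Suc by (simp add: add_ac)
qed simp

abbreviation pent :: "int \<Rightarrow> int" where
  "pent j \<equiv> j * (3 * j - 1)"

text \<open>Confines the sums over all integers \<open>j\<close> to a finite window, since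
  \<open>pent j\<close> exceeds \<open>n\<close> once \<open>\<bar>j\<bar>\<close> does.\<close>

lemma abs_le_pent: "\<bar>j\<bar> \<le> pent j"
proof (cases "j \<ge> 1")
  case True
  then show ?thesis using mult_left_mono[of 1 "3 * j - 1" j] by simp
next
  case False
  then show ?thesis using mult_left_mono[of 1 "- (3 * j - 1)" "-j"] by (simp add: algebra_simps)
qed

abbreviation even_prod :: "nat \<Rightarrow> int fps" where
  "even_prod N \<equiv> (\<Prod>i=1..N. 1 - fps_X ^ (2 * i))"

text \<open>In \<open>pentagonal_finite\<close> at \<open>y = fps_X\<close>, the summand
  \<open>s = 0\<close> is \<open>even_prod N\<close> and all others have order above
  \<open>n\<close>. The two exponents for \<open>j\<close> belong to the integers \<open>j\<close>
  and \<open>- j\<close>.\<close>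

lemma even_prod_pentagonal:
  assumes "n \<le> N"
  shows "eq_upto n (even_prod N) (\<Sum>j\<in>{- int N..int N}. (-1) ^ nat \<bar>j\<bar> * fps_X ^ nat (pent j))"
proof -
  have e: "nat (pent (int j)) = j * (3 * j - 1)" "nat (pent (- int j)) = j * (3 * j + 1)" if "j \<ge> 1" for j
  proof -
    have "pent (int j) = int (j * (3 * j - 1))" "pent (- int j) = int (j * (3 * j + 1))"
      using that by (simp_all add: of_nat_diff algebra_simps)
    then show "nat (pent (int j)) = j * (3 * j - 1)" "nat (pent (- int j)) = j * (3 * j + 1)"
      by (simp_all only: nat_int)
  qed
  have "(\<Sum>j\<in>{- int N..int N}. (-1) ^ nat \<bar>j\<bar> * fps_X ^ nat (pent j)) =
    1 + (\<Sum>j=1..N. (-1) ^ j * (fps_X ^ (j * (3 * j - 1)) + fps_X ^ (j * (3 * j + 1)) :: int fps))"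
    unfolding sum_symmetric_interval using e
    by (intro arg_cong2[of _ _ _ _ "(+)"] sum.cong refl) (simp_all add: distrib_left)
  also have "\<dots> = (\<Sum>s<Suc N. (-1) ^ s * (\<Prod>i=s+1..N. 1 - fps_X ^ (2 * i)) * fps_X ^ (2 * s * N + s * (s + 1)))"
    unfolding pentagonal_finite[symmetric] by (simp only: lessThan_Suc_atMost atMost_atLeast0)
  also have "eq_upto n \<dots> ((-1) ^ 0 * (\<Prod>i=0+1..N. 1 - fps_X ^ (2 * i)) * fps_X ^ (2 * 0 * N + 0 * (0 + 1)))"
  proof (rule eq_upto_first_term)
    fix s assume "s \<in> {0<..<Suc N}"
    then have "n < 2 * s * N + s * (s + 1)" using assms
      by (cases s) auto
    then show "eq_upto n ((-1) ^ s * (\<Prod>i=s+1..N. 1 - fps_X ^ (2 * i)) * fps_X ^ (2 * s * N + s * (s + 1)) :: int fps) 0"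
      by (rule eq_upto_X_power)
  qed simp
  finally show ?thesis by (simp add: eq_upto_sym)
qed

text \<open>With \<open>UO\<close>, \<open>UE\<close> the odd and even halves of
  \<open>geo_prod\<close>, Gauss's identity turns the triangular sum into \<open>QE * UO\<close>, so
  the left side becomes \<open>UO * UO\<close>. Euler's identity \<open>D = UO\<close>, distinct
  against odd parts, makes this \<open>D * D\<close>. The even length \<open>2*p\<close> gives both
  halves \<open>p\<close> factors.\<close>

lemma triangular_series_times_geo_prod:
  assumes "n < 2 * p"
  shows "eq_upto n ((\<Sum>m=0..2*p. fps_X ^ (\<Sum>{1..m})) * geo_prod (2*p))
           (even_prod (2*p) * (\<Prod>i=1..2*p. overp i))"
proof -
  define UO UE QO QE :: "int fps" where
    "UO = (\<Prod>i<p. geo (2*i+1))" and "UE = (\<Prod>i<p. geo (2*i+2))" and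
    "QO = (\<Prod>i<p. 1 - fps_X ^ (2*i+1))" and "QE = (\<Prod>i<p. 1 - fps_X ^ (2*i+2))"
  define D :: "int fps" where "D = (\<Prod>i=1..2*p. 1 + fps_X ^ i)"
  define Q :: "int fps" where "Q = (\<Prod>i=1..2*p. 1 - fps_X ^ i)"
  have geo: "(1 - fps_X ^ Suc i) * geo (Suc i) = (1 :: int fps)" for i
    by (rule geo_mult) simp
  have QO: "QO * UO = 1" and QE: "QE * UE = 1"
    unfolding QO_def UO_def QE_def UE_def prod.distrib[symmetric] by (simp_all add: geo del: power_Suc)
  have U: "geo_prod (2*p) = UO * UE"
    unfolding UO_def UE_def by (induction p) (simp_all add: mult_ac)
  have Q: "Q = QO * QE"
    unfolding Q_def QO_def QE_def by (induction p) (simp_all add: mult_ac)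
  have QU: "Q * geo_prod (2*p) = 1"
    unfolding U Q using QO QE by (metis mult.assoc mult.left_commute mult_1_right)
  have DQ: "even_prod (2*p) = D * Q"
    unfolding D_def Q_def prod.distrib[symmetric]
    by (intro prod.cong) (simp_all add: algebra_simps power_add[symmetric] mult_2)
  \<comment> \<open>Factors with \<open>i > p\<close> are 1 up to degree \<open>n\<close>, so
    \<open>D * Q\<close> agrees with \<open>QE\<close>; cancelling \<open>Q = QO * QE\<close> leaves
    Euler's identity.\<close>
  have "even_prod (2*p) = QE * (\<Prod>i=p+1..2*p. 1 - fps_X ^ (2 * i))"
  proof -
    have "QE = even_prod p"
      unfolding QE_def by (rule prod.reindex_bij_witness[of _ "\<lambda>i. i - 1" Suc]) auto
    then show ?thesis by (simp only: prod_split_interval[of 1 p "2*p"] Suc_eq_plus1)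
  qed
  also have "eq_upto n \<dots> (QE * 1)"
  proof (intro eq_upto_mult eq_upto_refl eq_upto_prod_one)
    fix i assume "i \<in> {p+1..2*p}"
    then have "eq_upto n (1 - 1 * fps_X ^ (2 * i)) (1 - 0 :: int fps)"
      using assms by (intro eq_upto_diff eq_upto_refl eq_upto_X_power) auto
    then show "eq_upto n (1 - fps_X ^ (2 * i)) (1 :: int fps)" by simp
  qed
  finally have "eq_upto n (D * (QO * QE)) (QE * 1)" unfolding DQ Q .
  then have "eq_upto n (D * (QO * QE) * (UO * UE)) (QE * 1 * (UO * UE))"
    by (rule eq_upto_mult[OF _ eq_upto_refl])
  moreover have "D * (QO * QE) * (UO * UE) = D * (QO * UO) * (QE * UE)"
    "QE * 1 * (UO * UE) = UO * (QE * UE)" by (simp_all add: mult_ac)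
  ultimately have D: "eq_upto n D UO" by (simp only: QO QE mult_1_right)
  \<comment> \<open>\<open>gauss_triangular_finite\<close> stops before \<open>m = 2*p\<close>; that
    last exponent is at least \<open>2*p > n\<close>, so its term drops out.\<close>
  have "(\<Sum>m=0..2*p. fps_X ^ (\<Sum>{1..m})) = (\<Sum>m<2*p. fps_X ^ (\<Sum>{1..m})) + 1 * (fps_X :: int fps) ^ (\<Sum>{1..2*p})"
    by (simp add: lessThan_Suc_atMost[symmetric] atMost_atLeast0[symmetric])
  also have "eq_upto n \<dots> ((\<Sum>m<2*p. fps_X ^ (\<Sum>{1..m})) + 0)"
  proof (intro eq_upto_add eq_upto_refl eq_upto_X_power)
    have "2 * p \<le> \<Sum>{1..2*p}" using assms by (intro member_le_sum) auto
    then show "n < \<Sum>{1..2*p}" using assms by simp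
  qed
  also have "(\<Sum>m<2*p. fps_X ^ (\<Sum>{1..m})) + 0 =
      (\<Sum>s<p. (\<Prod>i=s..<p. (1 - fps_X ^ (2 * i + 2)) * geo (2 * i + 1)) * fps_X ^ (s * (2 * p + 1)) :: int fps)"
    by (subst gauss_triangular_finite) (simp_all add: geo del: power_Suc)
  also have "eq_upto n \<dots> ((\<Prod>i=0..<p. (1 - fps_X ^ (2 * i + 2)) * geo (2 * i + 1)) * fps_X ^ (0 * (2 * p + 1)))"
  proof (rule eq_upto_first_term)
    fix s assume "s \<in> {0<..<p}"
    then have "n < s * (2 * p + 1)" using assms by (cases s) auto
    then show "eq_upto n ((\<Prod>i=s..<p. (1 - fps_X ^ (2 * i + 2)) * geo (2 * i + 1)) * fps_X ^ (s * (2 * p + 1)) :: int fps) 0"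
      by (rule eq_upto_X_power)
  qed (use assms in auto)
  also have "\<dots> = QE * UO"
    by (simp add: QE_def UO_def prod.distrib atLeast0LessThan)
  finally have "eq_upto n ((\<Sum>m=0..2*p. fps_X ^ (\<Sum>{1..m})) * geo_prod (2*p)) (QE * UO * (UO * UE))"
    unfolding U by (intro eq_upto_mult eq_upto_refl)
  also have "QE * UO * (UO * UE) = UO * UO * (QE * UE)" by (simp add: mult_ac)
  also have "eq_upto n \<dots> (D * D * 1)"
    unfolding QE by (intro eq_upto_mult eq_upto_refl eq_upto_sym[OF D])
  also have "D * D * 1 = D * D * (Q * geo_prod (2*p))" unfolding QU ..
  also have "\<dots> = even_prod (2*p) * (\<Prod>i=1..2*p. overp i)"
    unfolding DQ prod.distrib D_def by (simp add: mult_ac)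
  finally show ?thesis .
qed

section \<open>\<open>Mbar_series\<close> as a truncated theta series\<close>

lemma Mbar_series_theta:
  assumes "n \<le> N" "k < N"
  shows "eq_upto n (Mbar_series k N)
    ((-1) ^ k * ((\<Prod>i=1..N. overp i) * (1 + 2 * (\<Sum>j=1..k. (-1) ^ j * fps_X ^ j\<^sup>2)) - 1))"
  using assms(2)
proof (induction k)
  case 0
  then show ?case by (simp add: Mbar_series_0 eq_upto_refl)
next
  case (Suc k)
  let ?P = "\<Prod>i=1..N. overp i"
  let ?T = "\<lambda>k. 1 + 2 * (\<Sum>j=1..k. (-1) ^ j * fps_X ^ j\<^sup>2) :: int fps"
  obtain r where r: "Mbar_series (Suc k) N + Mbar_series k N =
      2 * fps_X ^ (Suc k)\<^sup>2 * ?P + fps_X ^ Suc N * r"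
    using Mbar_series_Suc[of k N] Suc.prems by auto
  have "Mbar_series (Suc k) N = 2 * fps_X ^ (Suc k)\<^sup>2 * ?P + r * fps_X ^ Suc N - Mbar_series k N"
    using r by (simp add: algebra_simps)
  also have "eq_upto n \<dots> (2 * fps_X ^ (Suc k)\<^sup>2 * ?P + 0 - (-1) ^ k * (?P * ?T k - 1))"
    using assms Suc by (intro eq_upto_add eq_upto_diff eq_upto_refl eq_upto_X_power) auto
  also have "2 * fps_X ^ (Suc k)\<^sup>2 * ?P + 0 - (-1) ^ k * (?P * ?T k - 1) = (-1) ^ Suc k * (?P * ?T (Suc k) - 1)"
  proof -
    have "(-1) ^ k * (-1) ^ k = (1 :: int fps)" by (simp add: power_mult_distrib[symmetric])
    moreover have "?T (Suc k) = ?T k - 2 * ((-1) ^ k * fps_X ^ (Suc k)\<^sup>2)"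
      by (simp add: algebra_simps)
    moreover have "2 * x * P + 0 - e * (P * t - 1) = - e * (P * (t - 2 * (e * x)) - 1)"
      if "e * e = 1" for e x P t :: "int fps"
    proof -
      have "- e * (P * (t - 2 * (e * x)) - 1) = 2 * x * P * (e * e) - e * (P * t - 1)"
        by (simp add: algebra_simps)
      then show ?thesis unfolding that by simp
    qed
    ultimately show ?thesis by simp
  qed
  finally show ?case .
qed

section \<open>Comparison of coefficients\<close>

lemma neg_one_power_fps: "(-1) ^ k = (fps_const ((-1) ^ k) :: int fps)"
  by (simp flip: fps_const_power fps_const_neg)

theorem theorem3:
  fixes k n :: nat
  assumes "k > 0" and "n > 0"
  shows "((\<lambda>j::int. (-1) ^ nat \<bar>j\<bar> * Mbar k (int n - j * (3 * j - 1))) has_sum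
           (-1) ^ k * (sigma_mex (int n)
             + 2 * (\<Sum>j = 1..k. (-1) ^ j * sigma_mex (int n - int j ^ 2))
             - delta' (int n))) UNIV"
proof -
  \<comment> \<open>Even for \<open>triangular_series_times_geo_prod\<close>, and larger than both
    \<open>n\<close> and \<open>k\<close>.\<close>
  define N where "N = 2 * (n + k + 1)"
  let ?S = "(\<Sum>m=0..N. fps_X ^ (\<Sum>{1..m})) * geo_prod N"
  let ?T = "1 + 2 * (\<Sum>j=1..k. (-1) ^ j * fps_X ^ j\<^sup>2) :: int fps"
  let ?E = "\<Sum>j\<in>{- int N..int N}. (-1) ^ nat \<bar>j\<bar> * fps_X ^ nat (pent j) :: int fps"
  let ?P = "\<Prod>i=1..N. overp i"
  have E: "eq_upto n (even_prod N) ?E"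
    by (rule even_prod_pentagonal) (simp add: N_def)
  have S: "eq_upto n ?S (even_prod N * ?P)"
    unfolding N_def by (rule triangular_series_times_geo_prod) simp
  have "eq_upto n (?E * Mbar_series k N) (even_prod N * ((-1) ^ k * (?P * ?T - 1)))"
    by (intro eq_upto_mult Mbar_series_theta eq_upto_sym[OF E]) (auto simp: N_def)
  also have "even_prod N * ((-1) ^ k * (?P * ?T - 1)) = (-1) ^ k * ((even_prod N * ?P) * ?T - even_prod N)"
    by (simp add: algebra_simps)
  also have "eq_upto n \<dots> ((-1) ^ k * (?S * ?T - ?E))"
    by (intro eq_upto_mult eq_upto_diff eq_upto_refl E eq_upto_sym[OF S])
  finally have main: "(?E * Mbar_series k N) $ n = ((-1) ^ k * (?S * ?T - ?E)) $ n"
    by (simp add: eq_upto_def)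

  have pos: "0 \<le> pent j" for j using abs_le_pent[of j] by linarith
  \<comment> \<open>The default value 0 at negative arguments, of \<open>sigma_mex\<close> and
    \<open>Mbar k\<close> alike, matches the vanishing coefficient when
    \<open>m > n\<close>.\<close>
  have shift: "(fps_X ^ m * f) $ n = g (int n - int m)"
    if "\<And>i. i \<le> n \<Longrightarrow> f $ i = g (int i)" "\<And>i. i < 0 \<Longrightarrow> g i = 0" for m g and f :: "int fps"
    using that by (auto simp: fps_X_power_mult_nth of_nat_diff)
  have "?E $ n = (\<Sum>j\<in>{- int N..int N}. if int n = pent j then (-1) ^ nat \<bar>j\<bar> else 0)"
    unfolding fps_sum_nth neg_one_power_fps using pos
    by (intro sum.cong refl) (auto simp: nat_eq_iff2)
  also have "\<dots> = delta' (int n)"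
  proof (cases "\<exists>m. int n = pent m")
    case True
    then obtain m where m: "int n = pent m" by blast
    then have "m \<in> {- int N..int N}" using abs_le_pent[of m] by (auto simp: N_def)
    moreover have "int n = pent j \<longleftrightarrow> j = m" for j
      using m pentagonal_inj by metis
    ultimately show ?thesis unfolding m delta'_eq using m by simp
  next
    case False
    then show ?thesis by (simp add: delta'_def)
  qed
  finally have E_n: "?E $ n = delta' (int n)" .
  have "(S * ?T) $ n = S $ n + 2 * (\<Sum>j=1..k. (-1) ^ j * (fps_X ^ j\<^sup>2 * S) $ n)" for S
  proof -
    have "S * ?T = S + fps_const 2 * (\<Sum>j=1..k. fps_const ((-1) ^ j) * (fps_X ^ j\<^sup>2 * S))"
      unfolding neg_one_power_fps by (simp add: distrib_left sum_distrib_left sum_distrib_right numeral_fps_const mult_ac)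
    then show ?thesis by (simp only: fps_add_nth fps_mult_left_const_nth fps_sum_nth)
  qed
  note this[of ?S]
  also have "?S $ n + 2 * (\<Sum>j=1..k. (-1) ^ j * (fps_X ^ j\<^sup>2 * ?S) $ n) = sigma_mex (int n) + 2 * (\<Sum>j=1..k. (-1) ^ j * sigma_mex (int n - int j ^ 2))"
    using shift[of ?S sigma_mex] sigma_mex_nth[of _ N]
    by (intro arg_cong2[of _ _ _ _ "(+)"] arg_cong2[of _ _ _ _ "(*)"] sum.cong refl)
       (auto simp: N_def sigma_mex_def)
  finally have rhs: "((-1) ^ k * (?S * ?T - ?E)) $ n = (-1) ^ k * (sigma_mex (int n)
             + 2 * (\<Sum>j = 1..k. (-1) ^ j * sigma_mex (int n - int j ^ 2)) - delta' (int n))"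
    using E_n by (simp only: neg_one_power_fps fps_mult_left_const_nth fps_sub_nth)

  have "(?E * Mbar_series k N) $ n = (\<Sum>j\<in>{- int N..int N}. (-1) ^ nat \<bar>j\<bar> * (fps_X ^ nat (pent j) * Mbar_series k N) $ n)"
    unfolding sum_distrib_right fps_sum_nth neg_one_power_fps mult.assoc fps_mult_left_const_nth ..
  also have "\<dots> = (\<Sum>j\<in>{- int N..int N}. (-1) ^ nat \<bar>j\<bar> * Mbar k (int n - pent j))"
  proof (intro sum.cong arg_cong2[of _ _ _ _ "(*)"] refl)
    fix j
    have "(fps_X ^ nat (pent j) * Mbar_series k N) $ n = Mbar k (int n - int (nat (pent j)))"
      using Mbar_nth[of _ N k] by (intro shift[of "Mbar_series k N" "Mbar k"]) (simp_all add: N_def, simp add: Mbar_def)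
    then show "(fps_X ^ nat (pent j) * Mbar_series k N) $ n = Mbar k (int n - pent j)"
      using pos[of j] by simp
  qed
  finally have lhs: "(\<Sum>j\<in>{- int N..int N}. (-1) ^ nat \<bar>j\<bar> * Mbar k (int n - pent j)) =
      (-1) ^ k * (sigma_mex (int n) + 2 * (\<Sum>j = 1..k. (-1) ^ j * sigma_mex (int n - int j ^ 2)) - delta' (int n))"
    using main rhs by simp
  have "((\<lambda>j. (-1) ^ nat \<bar>j\<bar> * Mbar k (int n - pent j)) has_sum
      (\<Sum>j\<in>{- int N..int N}. (-1) ^ nat \<bar>j\<bar> * Mbar k (int n - pent j))) {- int N..int N}"
    by (rule has_sum_finite) simp
  \<comment> \<open>Outside the window the argument of \<open>Mbar k\<close> is negative, so the sum
    over all integers is the finite one.\<close>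
  moreover have "Mbar k (int n - pent j) = 0" if "j \<notin> {- int N..int N}" for j
  proof -
    have "int n < \<bar>j\<bar>" using that by (auto simp: N_def)
    then have "int n < pent j" using abs_le_pent by (rule order.strict_trans2)
    then show ?thesis by (simp add: Mbar_def)
  qed
  then have "((\<lambda>j. (-1) ^ nat \<bar>j\<bar> * Mbar k (int n - pent j)) has_sum x) UNIV \<longleftrightarrow>
      ((\<lambda>j. (-1) ^ nat \<bar>j\<bar> * Mbar k (int n - pent j)) has_sum x) {- int N..int N}" for x
    by (intro has_sum_cong_neutral) auto
  ultimately show ?thesis
    unfolding lhs by blast
qed

end
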